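(* For each positive integer $N$, \[ \frac{K(N)\cdot N}{\phi(N)}=\prod_\ell\left(\lim_{e\to\infty}\frac{\ell^e\cdot\#\{\sigma\in\mathrm{GL}_2(\mathbb Z/\ell^e\mathbb Z):\det(\sigma)+1-\mathrm{tr}(\sigma)\equiv N\pmod{\ell^e}\}}{\#\mathrm{GL}_2(\mathbb Z/\ell^e\mathbb Z)}\right), \] the product over all primes $\ell$. Furthermore, for each $\ell$ the sequence whose limit is taken is constant for $e>\nu_\ell(N)$.
   Context: $K(N)=\prod_{\ell\nmid N}\left(1-\frac{\left(\frac{N-1}{\ell}\right)^2\ell+1}{(\ell-1)^2(\ell+1)}\right)\prod_{\ell\mid N}\left(1-\frac{1}{\ell^{\nu_\ell(N)}(\ell-1)}\right)$, products over primes $\ell$, $\left(\frac\cdot\ell\right)$ the Kronecker symbol, $\nu_\ell$ the $\ell$-adic valuation, and $\phi$ Euler's function. *)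

theory Defs
  imports "HOL-Analysis.Analysis" "HOL-Number_Theory.Number_Theory"
begin

text \<open>
  The Kronecker symbol with prime denominator. The library's Legendre symbol is not the
  Kronecker symbol at 2: it takes the value 1 at every odd number.
\<close>

definition kronecker_prime :: "int \<Rightarrow> nat \<Rightarrow> int" where
  "kronecker_prime a l =
     (if l = 2 then (if even a then 0 else if a mod 8 = 1 \<or> a mod 8 = 7 then 1 else -1)
      else Legendre a (int l))"

text \<open>
  An infinite product over primes is written as an infinite product over all natural numbers
  in which the factors at non-primes are 1.
\<close>

definition K_coprime_factor :: "nat \<Rightarrow> nat \<Rightarrow> real" where
  "K_coprime_factor N l =
     1 - (of_int ((kronecker_prime (int N - 1) l)\<^sup>2) * real l + 1)
           / ((real l - 1)\<^sup>2 * (real l + 1))"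

definition K_const :: "nat \<Rightarrow> real" where
  "K_const N =
     (\<Prod>l. if prime l \<and> \<not> l dvd N then K_coprime_factor N l else 1) *
     (\<Prod>l\<in>prime_factors N. 1 - 1 / (real l ^ multiplicity l N * (real l - 1)))"

text \<open>
  A matrix over \<open>\<int>/m\<int>\<close> is represented by the integer matrix of its canonical representatives
  in \<open>{0..<m}\<close>. Since reduction mod \<open>m\<close> is a ring homomorphism, matrix product, determinant and
  trace over \<open>\<int>/m\<int>\<close> are those of integer matrices taken up to congruence.
\<close>

definition mat_cong :: "int^2^2 \<Rightarrow> int^2^2 \<Rightarrow> nat \<Rightarrow> bool" where
  "mat_cong A B m \<longleftrightarrow> (\<forall>i j. [A $ i $ j = B $ i $ j] (mod int m))"

definition Mat2_mod :: "nat \<Rightarrow> (int^2^2) set" where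
  "Mat2_mod m = {A. \<forall>i j. A $ i $ j \<in> {0..<int m}}"

definition GL2_mod :: "nat \<Rightarrow> (int^2^2) set" where
  "GL2_mod m =
     {A \<in> Mat2_mod m. \<exists>B \<in> Mat2_mod m. mat_cong (A ** B) (mat 1) m \<and> mat_cong (B ** A) (mat 1) m}"

definition local_ratio :: "nat \<Rightarrow> nat \<Rightarrow> nat \<Rightarrow> real" where
  "local_ratio N l e =
     real (l ^ e) *
       real (card {A \<in> GL2_mod (l ^ e). [det A + 1 - trace A = int N] (mod int (l ^ e))})
     / real (card (GL2_mod (l ^ e)))"

lemma finite_GL2_mod: "finite (GL2_mod m)"
proof -
  let ?S = "{0..<int m}"
  have "Mat2_mod m \<subseteq> {A. \<forall>i. A $ i \<in> {v. \<forall>j. v $ j \<in> ?S}}"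
    by (auto simp: Mat2_mod_def)
  moreover have "finite {A :: int^2^2. \<forall>i. A $ i \<in> {v. \<forall>j. v $ j \<in> ?S}}"
  proof (rule finite_subset)
    let ?f = "\<lambda>(a, b, c, d). \<chi> i j. if i = (1::2) then (if j = (1::2) then a else b)
                                        else (if j = 1 then c else d)"
    show "{A :: int^2^2. \<forall>i. A $ i \<in> {v. \<forall>j. v $ j \<in> ?S}} \<subseteq> ?f ` (?S \<times> ?S \<times> ?S \<times> ?S)"
    proof
      fix A :: "int^2^2" assume "A \<in> {A. \<forall>i. A $ i \<in> {v. \<forall>j. v $ j \<in> ?S}}"
      then have "(A$1$1, A$1$2, A$2$1, A$2$2) \<in> ?S \<times> ?S \<times> ?S \<times> ?S"
        by simp
      moreover have "A = ?f (A$1$1, A$1$2, A$2$1, A$2$2)"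
        by (simp add: vec_eq_iff forall_2)
      ultimately show "A \<in> ?f ` (?S \<times> ?S \<times> ?S \<times> ?S)"
        by (rule rev_image_eqI)
    qed
  qed auto
  ultimately show ?thesis
    by (auto simp: GL2_mod_def intro: finite_subset)
qed

lemma kronecker_prime_square_le: "(kronecker_prime a l)\<^sup>2 \<le> 1"
  by (auto simp: kronecker_prime_def Legendre_def)

lemma abs_convergent_K:
  "abs_convergent_prod (\<lambda>l. if prime l \<and> \<not> l dvd N then K_coprime_factor N l else 1)"
proof (rule summable_imp_abs_convergent_prod, rule summable_comparison_test')
  show "summable (\<lambda>l. 4 * inverse (real l ^ 2))"
    by (intro summable_mult inverse_power_summable) simp
next
  fix l :: nat assume l: "l \<ge> 2"
  define c where "c = (of_int ((kronecker_prime (int N - 1) l)\<^sup>2) :: real)"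
  have c: "0 \<le> c" "c \<le> 1"
    using kronecker_prime_square_le[of "int N - 1" l] unfolding c_def
    by (simp_all only: of_int_0_le_iff of_int_le_1_iff zero_le_power2)
  have "(c * real l + 1) / ((real l - 1)\<^sup>2 * (real l + 1))
        \<le> (real l + 1) / ((real l - 1)\<^sup>2 * (real l + 1))"
    using c l by (intro divide_right_mono add_right_mono) (auto intro: mult_left_le_one_le)
  also have "\<dots> = 1 / (real l - 1)\<^sup>2"
    using l nonzero_mult_divide_mult_cancel_right[of "real l + 1" 1 "(real l - 1)\<^sup>2"] by simp
  also have "\<dots> \<le> 1 / (real l / 2)\<^sup>2"
    using l by (intro divide_left_mono power_mono mult_pos_pos) auto
  also have "\<dots> = 4 * inverse (real l ^ 2)"
    by (simp add: field_simps power2_eq_square)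
  finally have upper: "(c * real l + 1) / ((real l - 1)\<^sup>2 * (real l + 1)) \<le> 4 * inverse (real l ^ 2)" .
  have "0 \<le> (c * real l + 1) / ((real l - 1)\<^sup>2 * (real l + 1))"
    using c by (intro divide_nonneg_nonneg mult_nonneg_nonneg add_nonneg_nonneg) auto
  moreover have "K_coprime_factor N l - 1 = - ((c * real l + 1) / ((real l - 1)\<^sup>2 * (real l + 1)))"
    unfolding K_coprime_factor_def c_def by simp
  ultimately show "norm (norm ((if prime l \<and> \<not> l dvd N then K_coprime_factor N l else 1) - 1))
        \<le> 4 * inverse (real l ^ 2)"
    using upper by auto
qed

end

theory Submission
  imports Defs
begin

text \<open>
  Put \<open>\<sigma> = M + 1\<close>. Then \<open>det \<sigma> + 1 - tr \<sigma> = det M\<close>, and if this is congruent to \<open>N\<close>, then \<open>\<sigma>\<close> is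
  invertible iff \<open>tr M \<noteq> - (N + 1)\<close> modulo \<open>l\<close>. So the count is the number of \<open>M\<close> of determinant \<open>N\<close>
  minus the number of those with the forbidden trace modulo \<open>l\<close>. The first number follows by
  recursion on \<open>\<nu>\<^sub>l(N)\<close>: a first row that does not vanish modulo \<open>l\<close> makes the determinant a
  unimodular linear form in the second row, and otherwise a factor \<open>l\<close> can be cancelled.
\<close>

(* As simp rules these would rewrite sums of indicators to cardinalities of intersections. *)
declare sum_of_bool_eq [simp del] sum_of_bool_mult_eq [simp del] sum_mult_of_bool_eq [simp del]

section \<open>Sums over residue systems\<close>

text \<open>Multiplication by a unit followed by a translation permutes the residues modulo
  \<open>m\<close>: it is an injective self-map of a finite set.\<close>

lemma sum_residues_affine:
  fixes m u k :: int and f :: "int \<Rightarrow> 'a :: comm_monoid_add"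
  assumes "m > 0" "coprime u m" and f: "\<And>x. f (x mod m) = f x"
  shows "(\<Sum>x\<in>{0..<m}. f (u * x + k)) = (\<Sum>x\<in>{0..<m}. f x)"
proof -
  let ?g = "\<lambda>x. (u * x + k) mod m"
  have "inj_on ?g {0..<m}"
  proof (rule inj_onI)
    fix x y assume *: "x \<in> {0..<m}" "y \<in> {0..<m}" "?g x = ?g y"
    then have "[u * x + k = u * y + k] (mod m)" by (simp add: cong_def)
    then have "[x = y] (mod m)"
      using assms(2) by (simp add: cong_add_rcancel cong_mult_lcancel)
    with * show "x = y" by (simp add: cong_def)
  qed
  moreover have "?g ` {0..<m} \<subseteq> {0..<m}" using \<open>m > 0\<close> by auto
  ultimately have "bij_betw ?g {0..<m} {0..<m}"
    by (simp add: bij_betw_def endo_inj_surj)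
  then have "(\<Sum>x\<in>{0..<m}. f (?g x)) = (\<Sum>x\<in>{0..<m}. f x)"
    by (rule sum.reindex_bij_betw)
  then show ?thesis by (simp only: f)
qed

lemma sum_residues_multiples:
  fixes p k :: int and f :: "int \<Rightarrow> 'a :: semiring_1"
  assumes "p > 0"
  shows "(\<Sum>x\<in>{0..<p * k}. of_bool (p dvd x) * f x) = (\<Sum>x\<in>{0..<k}. f (p * x))"
proof -
  have "(\<Sum>x\<in>{0..<p * k}. of_bool (p dvd x) * f x) = (\<Sum>x\<in>{x\<in>{0..<p * k}. p dvd x}. f x)"
    by (rule sum.mono_neutral_cong_right) auto
  also have "\<dots> = (\<Sum>x\<in>{0..<k}. f (p * x))"
    by (rule sum.reindex_bij_witness[of _ "\<lambda>x. p * x" "\<lambda>x. x div p"])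
       (use assms in \<open>auto simp: zero_le_mult_iff dest: pos_imp_zdiv_nonneg_iff elim!: dvdE\<close>)
  finally show ?thesis .
qed

text \<open>Division with remainder by \<open>k\<close> cuts the interval into \<open>p\<close> full
  periods of \<open>f\<close>.\<close>

lemma sum_residues_blocks:
  fixes p k :: int and f :: "int \<Rightarrow> real"
  assumes "p > 0" "k > 0" and f: "\<And>x. f (x mod k) = f x"
  shows "(\<Sum>x\<in>{0..<p * k}. f x) = of_int p * (\<Sum>x\<in>{0..<k}. f x)"
proof -
  have "(\<Sum>x\<in>{0..<p * k}. f x) = (\<Sum>(i, j)\<in>{0..<p} \<times> {0..<k}. f j)"
  proof (rule sum.reindex_bij_witness[of _ "\<lambda>(i, j). i * k + j" "\<lambda>x. (x div k, x mod k)"])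
    fix a assume a: "a \<in> {0..<p * k}"
    show "(case (a div k, a mod k) of (i, j) \<Rightarrow> i * k + j) = a" by simp
    show "(a div k, a mod k) \<in> {0..<p} \<times> {0..<k}"
    proof -
      have "a div k * k \<le> a" using assms(2) by (simp add: minus_mod_eq_div_mult [symmetric])
      also have "a < p * k" using a by simp
      finally have "a div k < p" using assms(2) by simp
      then show ?thesis using a assms(2) by (simp add: pos_imp_zdiv_nonneg_iff)
    qed
    show "(case (a div k, a mod k) of (i, j) \<Rightarrow> f j) = f a" by (simp add: f)
  next
    fix b assume b: "b \<in> {0..<p} \<times> {0..<k}"
    then obtain i j where [simp]: "b = (i, j)" and ij: "0 \<le> i" "i < p" "0 \<le> j" "j < k" by auto
    show "((case b of (i, j) \<Rightarrow> i * k + j) div k, (case b of (i, j) \<Rightarrow> i * k + j) mod k) = b"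
      using ij by simp
    have "i * k + j < (i + 1) * k" using ij by (simp add: algebra_simps)
    also have "\<dots> \<le> p * k" using ij by (intro mult_right_mono) auto
    finally show "(case b of (i, j) \<Rightarrow> i * k + j) \<in> {0..<p * k}" using ij by simp
  qed
  also have "\<dots> = (\<Sum>i\<in>{0..<p}. \<Sum>j\<in>{0..<k}. f j)"
    by (rule sum.cartesian_product [symmetric])
  finally show ?thesis using assms(1) by simp
qed

text \<open>A linear congruence with a unit coefficient has exactly one root. This eliminates a
  matrix entry whose cofactor is a unit.\<close>

lemma sum_residues_unique:
  fixes m u k :: int
  assumes "m > 0" "coprime u m"
  shows "(\<Sum>x\<in>{0..<m}. of_bool (m dvd u * x + k)) = (1 :: real)"
proof -
  have "(\<Sum>x\<in>{0..<m}. of_bool (m dvd u * x + k)) = (\<Sum>x\<in>{0..<m}. of_bool (m dvd x) :: real)"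
    by (rule sum_residues_affine[OF assms]) (simp add: dvd_eq_mod_eq_0)
  also have "\<dots> = (\<Sum>x\<in>{0..<m}. of_bool (x = 0))"
    by (intro sum.cong arg_cong[where f = of_bool]) (auto dest: zdvd_imp_le)
  also have "\<dots> = 1" using assms(1) by (simp add: of_bool_def)
  finally show ?thesis .
qed

text \<open>There is one root modulo \<open>p\<close>, and it has \<open>k\<close> lifts modulo
  \<open>p * k\<close>.\<close>

lemma sum_residues_unique_divisor:
  fixes p k u c :: int
  assumes "p > 0" "k > 0" "coprime u p"
  shows "(\<Sum>x\<in>{0..<p * k}. of_bool (p dvd u * x + c)) = real_of_int k"
proof -
  have "(\<Sum>x\<in>{0..<k * p}. of_bool (p dvd u * x + c)) = of_int k * (\<Sum>x\<in>{0..<p}. of_bool (p dvd u * x + c) :: real)"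
    using assms(2,1)
  proof (rule sum_residues_blocks)
    show "of_bool (p dvd u * (x mod p) + c) = (of_bool (p dvd u * x + c) :: real)" for x
      by (intro arg_cong[where f = of_bool] cong_dvd_iff cong_add cong_mult cong_refl) simp
  qed
  then show ?thesis using assms by (simp only: sum_residues_unique mult.commute[of k p])
qed

lemma sum_residues_coprime:
  fixes p k :: int
  assumes "p > 0" "k > 0"
  shows "(\<Sum>x\<in>{0..<p * k}. of_bool (\<not> p dvd x)) = of_int p * of_int k - real_of_int k"
proof -
  have "(\<Sum>x\<in>{0..<p * k}. of_bool (\<not> p dvd x)) + (\<Sum>x\<in>{0..<p * k}. of_bool (p dvd x)) = (\<Sum>x\<in>{0..<p * k}. 1 :: real)"
    unfolding sum.distrib[symmetric] by (intro sum.cong) auto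
  moreover have "(\<Sum>x\<in>{0..<p * k}. of_bool (p dvd x)) = real_of_int k"
    using sum_residues_unique_divisor[of p k 1 0] assms by simp
  ultimately show ?thesis using assms by simp
qed


section \<open>Counting 2x2 matrices by determinant\<close>

text \<open>The quadruple stands for the matrix with rows (a, b) and (c, d). Nested sums of real
  indicators allow single entries to be summed out in a convenient order and counts to be subtracted
  and divided.\<close>

definition quad_count :: "int \<Rightarrow> (int \<Rightarrow> int \<Rightarrow> int \<Rightarrow> int \<Rightarrow> bool) \<Rightarrow> real" where
  "quad_count m P = (\<Sum>a\<in>{0..<m}. \<Sum>b\<in>{0..<m}. \<Sum>c\<in>{0..<m}. \<Sum>d\<in>{0..<m}. of_bool (P a b c d))"

lemma quad_count_cong:
  "(\<And>a b c d. P a b c d \<longleftrightarrow> Q a b c d) \<Longrightarrow> quad_count m P = quad_count m Q"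
  by (simp add: quad_count_def)

lemma quad_count_split:
  "quad_count m P = quad_count m (\<lambda>a b c d. P a b c d \<and> Q a b c d) + quad_count m (\<lambda>a b c d. P a b c d \<and> \<not> Q a b c d)"
  unfolding quad_count_def sum.distrib[symmetric] by (intro sum.cong refl) auto

text \<open>Isolates the dichotomy behind the next two counts: (pk)^2 - k^2 first rows do not vanish
  modulo \<open>p\<close>, and each admits \<open>r\<close> second rows; the other first rows are
  \<open>p\<close> times a row modulo \<open>k\<close>.\<close>

lemma quad_count_rows:
  fixes p k :: int
  assumes "p > 0" "k > 0"
    and row: "\<And>a b. \<not> (p dvd a \<and> p dvd b) \<Longrightarrow>
      (\<Sum>c\<in>{0..<p * k}. \<Sum>d\<in>{0..<p * k}. of_bool (P a b c d)) = r"
  shows "quad_count (p * k) P = ((of_int p * of_int k)\<^sup>2 - (of_int k)\<^sup>2) * r +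
    (\<Sum>a\<in>{0..<k}. \<Sum>b\<in>{0..<k}. \<Sum>c\<in>{0..<p * k}. \<Sum>d\<in>{0..<p * k}. of_bool (P (p * a) (p * b) c d))"
proof -
  let ?I = "{0..<p * k}"
  define F where "F a b = (\<Sum>c\<in>?I. \<Sum>d\<in>?I. of_bool (P a b c d) :: real)" for a b
  \<comment> \<open>Every first row is charged \<open>r\<close>; a row divisible by \<open>p\<close>
    has this taken back and its true count \<open>F a b\<close> added.\<close>
  have "quad_count (p * k) P = (\<Sum>a\<in>?I. \<Sum>b\<in>?I. (r - of_bool (p dvd a) * of_bool (p dvd b) * r)
      + of_bool (p dvd a) * (of_bool (p dvd b) * F a b))"
    unfolding quad_count_def F_def[symmetric]
    by (intro sum.cong refl) (use row in \<open>auto simp: F_def of_bool_def\<close>)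
  also have "\<dots> = (\<Sum>a\<in>?I. \<Sum>b\<in>?I. r) -
      (\<Sum>a\<in>?I. of_bool (p dvd a) * (\<Sum>b\<in>?I. of_bool (p dvd b) * r)) +
      (\<Sum>a\<in>?I. of_bool (p dvd a) * (\<Sum>b\<in>?I. of_bool (p dvd b) * F a b))"
    by (simp only: sum.distrib sum_subtractf sum_distrib_left mult.assoc)
  also have "\<dots> = (of_int p * of_int k)\<^sup>2 * r - (of_int k)\<^sup>2 * r + (\<Sum>a\<in>{0..<k}. \<Sum>b\<in>{0..<k}. F (p * a) (p * b))"
    unfolding sum_residues_multiples[OF assms(1)] using assms(1,2) by (simp add: power2_eq_square)
  finally show ?thesis by (simp add: F_def algebra_simps)
qed

text \<open>For a prime power \<open>p * k\<close> this is the order of GL2. A first row with an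
  entry prime to \<open>p\<close> leaves one entry of the second row free and
  \<open>p * k - k\<close> values for the other; a first row divisible by \<open>p\<close>
  contributes nothing.\<close>

lemma quad_count_unit_det:
  fixes p k :: int
  assumes "prime p" "k > 0"
  shows "quad_count (p * k) (\<lambda>a b c d. \<not> p dvd a * d - b * c) =
    ((of_int p * of_int k)\<^sup>2 - (of_int k)\<^sup>2) * (of_int p * of_int k * (of_int p * of_int k - of_int k))"
proof -
  have p: "p > 0" using assms(1) by (rule prime_gt_0_int)
  have key: "(\<Sum>x\<in>{0..<p * k}. of_bool (\<not> p dvd u * x + c)) = of_int p * of_int k - real_of_int k"
    if "\<not> p dvd u" for u c
  proof -
    have "coprime u p" using assms(1) that by (simp add: prime_imp_coprime coprime_commute)
    then have "(\<Sum>x\<in>{0..<p * k}. of_bool (p dvd u * x + c)) = real_of_int k"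
      using p assms(2) by (intro sum_residues_unique_divisor)
    moreover have "(\<Sum>x\<in>{0..<p * k}. of_bool (\<not> p dvd u * x + c)) +
        (\<Sum>x\<in>{0..<p * k}. of_bool (p dvd u * x + c)) = (\<Sum>x\<in>{0..<p * k}. 1 :: real)"
      unfolding sum.distrib[symmetric] by (intro sum.cong) auto
    ultimately show ?thesis using p assms(2) by simp
  qed
  have row: "(\<Sum>c\<in>{0..<p * k}. \<Sum>d\<in>{0..<p * k}. of_bool (\<not> p dvd a * d - b * c)) =
      of_int p * of_int k * (of_int p * of_int k - real_of_int k)"
    if "\<not> (p dvd a \<and> p dvd b)" for a b
  \<comment> \<open>The innermost summation variable must have a unit coefficient: this is
    \<open>d\<close> if \<open>p\<close> does not divide \<open>a\<close>, and otherwise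
    \<open>c\<close> with coefficient \<open>- b\<close>.\<close>
  proof (cases "p dvd a")
    case False
    have "(\<Sum>d\<in>{0..<p * k}. of_bool (\<not> p dvd a * d - b * c)) = of_int p * of_int k - real_of_int k" for c
      using key[OF False, of "- (b * c)"] by (simp only: diff_conv_add_uminus)
    then show ?thesis using p assms(2) by simp
  next
    case True
    then have "\<not> p dvd - b" using that by simp
    from key[OF this] have "(\<Sum>c\<in>{0..<p * k}. of_bool (\<not> p dvd a * d - b * c)) = of_int p * of_int k - real_of_int k" for d
      by (simp only: diff_conv_add_uminus mult_minus_left add.commute)
    then show ?thesis by (subst sum.swap) (use p assms(2) in simp)
  qed
  show ?thesis
    by (subst quad_count_rows[OF p assms(2) row]) (simp_all add: mult.assoc flip: right_diff_distrib)
qed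

text \<open>Assumption \<open>k\<close> stands in for \<open>p * k\<close> being a power of
  \<open>p\<close>: units are recognised modulo \<open>p\<close>. A first row not vanishing modulo
  \<open>p\<close> makes the determinant a unimodular form, with \<open>p * k\<close> solutions; in
  any other row \<open>p\<close> can be cancelled, provided that it divides
  \<open>n\<close>.\<close>

lemma quad_count_det_rec:
  fixes p k n :: int
  assumes "prime p" "k > 0" and k: "\<And>u. coprime u (p * k) \<longleftrightarrow> \<not> p dvd u"
  shows "quad_count (p * k) (\<lambda>a b c d. p * k dvd a * d - b * c - n) =
    ((of_int p * of_int k)\<^sup>2 - (of_int k)\<^sup>2) * (of_int p * of_int k) +
    (if p dvd n then (of_int p)\<^sup>2 * quad_count k (\<lambda>a b c d. k dvd a * d - b * c - n div p) else 0)"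
  (is "_ = _ + ?R")
proof -
  have p: "p > 0" using assms(1) by (rule prime_gt_0_int)
  then have m: "p * k > 0" using assms(2) by simp
  have row: "(\<Sum>c\<in>{0..<p * k}. \<Sum>d\<in>{0..<p * k}. of_bool (p * k dvd a * d - b * c - n)) = real_of_int p * of_int k"
    if "\<not> (p dvd a \<and> p dvd b)" for a b
  proof (cases "p dvd a")
    case False
    then have "coprime a (p * k)" by (simp only: k not_False_eq_True)
    from sum_residues_unique[OF m this, of "- (b * c + n)" for c]
    have "(\<Sum>d\<in>{0..<p * k}. of_bool (p * k dvd a * d - b * c - n)) = (1::real)" for c
      by (simp only: diff_conv_add_uminus minus_add_distrib add.assoc)
    then show ?thesis using p assms(2) by simp
  next
    case True
    then have "coprime (- b) (p * k)" using that True by (simp only: k dvd_minus_iff simp_thms)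
    have "(\<Sum>c\<in>{0..<p * k}. of_bool (p * k dvd a * d - b * c - n)) = (1::real)" for d
    proof -
      have "a * d - b * c - n = - b * c + (a * d - n)" for c by simp
      with sum_residues_unique[OF m \<open>coprime (- b) (p * k)\<close>, of "a * d - n"] show ?thesis by (simp only:)
    qed
    then show ?thesis by (subst sum.swap) (use p assms(2) in simp)
  qed
  have "(\<Sum>a\<in>{0..<k}. \<Sum>b\<in>{0..<k}. \<Sum>c\<in>{0..<p * k}. \<Sum>d\<in>{0..<p * k}.
      of_bool (p * k dvd p * a * d - p * b * c - n)) = ?R"
  proof (cases "p dvd n")
    case True
    then obtain n' where n: "n = p * n'" ..
    have "(p * k dvd p * a * d - p * b * c - n) = (k dvd a * d - b * c - n')" for a b c d
    proof -
      have "p * a * d - p * b * c - n = p * (a * d - b * c - n')" by (simp add: n algebra_simps)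
      then show ?thesis using p by simp
    qed
    \<comment> \<open>After the cancellation the condition has period \<open>k\<close>, but
      \<open>c\<close> and \<open>d\<close> still run modulo \<open>p * k\<close>: each contributes
      one factor \<open>p\<close>.\<close>
    moreover have "(\<Sum>c\<in>{0..<p * k}. \<Sum>d\<in>{0..<p * k}. of_bool (k dvd a * d - b * c - n')) =
        (of_int p)\<^sup>2 * (\<Sum>c\<in>{0..<k}. \<Sum>d\<in>{0..<k}. of_bool (k dvd a * d - b * c - n') :: real)" for a b
    proof -
      have "(\<Sum>d\<in>{0..<p * k}. of_bool (k dvd a * d - b * c - n')) =
          of_int p * (\<Sum>d\<in>{0..<k}. of_bool (k dvd a * d - b * c - n') :: real)" for c
        by (rule sum_residues_blocks[OF p assms(2)],
            intro arg_cong[where f = of_bool] cong_dvd_iff cong_diff cong_mult cong_refl) simp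
      then have "(\<Sum>c\<in>{0..<p * k}. \<Sum>d\<in>{0..<p * k}. of_bool (k dvd a * d - b * c - n')) =
          of_int p * (\<Sum>c\<in>{0..<p * k}. \<Sum>d\<in>{0..<k}. of_bool (k dvd a * d - b * c - n') :: real)"
        by (simp only: sum_distrib_left)
      also have "(\<Sum>c\<in>{0..<p * k}. \<Sum>d\<in>{0..<k}. of_bool (k dvd a * d - b * c - n') :: real) =
          of_int p * (\<Sum>c\<in>{0..<k}. \<Sum>d\<in>{0..<k}. of_bool (k dvd a * d - b * c - n'))"
        by (rule sum_residues_blocks[OF p assms(2)],
            intro sum.cong refl arg_cong[where f = of_bool] cong_dvd_iff cong_diff cong_mult cong_refl) simp
      finally show ?thesis by (simp only: power2_eq_square mult.assoc)
    qed
    ultimately show ?thesis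
      using p True by (simp add: n quad_count_def sum_distrib_left del: sum_of_bool_eq)
  next
    case False
    have "\<not> p * k dvd p * a * d - p * b * c - n" for a b c d
    proof
      assume "p * k dvd p * a * d - p * b * c - n"
      then have "p dvd p * a * d - p * b * c - n" by (rule dvd_mult_left)
      moreover have "p * a * d - p * b * c - n = p * (a * d - b * c) - n" by (simp add: algebra_simps)
      ultimately have "p dvd p * (a * d - b * c) - n" by simp
      then have "p dvd n" by (simp add: dvd_diff_right_iff)
      with False show False ..
    qed
    then show ?thesis using False by simp
  qed
  then show ?thesis by (subst quad_count_rows[OF p assms(2) row]) simp_all
qed


text \<open>Discharges assumption \<open>k\<close> of the recursion. The factor \<open>p\<close> in
  front keeps the exponent positive; modulo 1 every integer would be a unit.\<close>

lemma coprime_prime_power_iff: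
  fixes p u :: int
  assumes "prime p"
  shows "coprime u (p * p ^ e) \<longleftrightarrow> \<not> p dvd u"
proof -
  have "coprime u (p ^ Suc e) \<longleftrightarrow> coprime u p"
    by (rule coprime_power_right_iff[THEN trans]) simp
  also have "\<dots> \<longleftrightarrow> \<not> p dvd u"
    using assms by (metis coprime_absorb_right coprime_commute not_prime_unit prime_imp_coprime)
  finally show ?thesis by simp
qed

text \<open>Iterating the recursion produces the geometric sum (1 - 1/p) (1 + 1/p + ... + 1/p^v) = 1
  - 1/p^(v+1). Since \<open>e > v\<close>, the modulus is still divisible by \<open>p\<close> when
  \<open>n\<close> has lost its last factor \<open>p\<close>.\<close>

lemma quad_count_det:
  fixes p n :: int
  assumes "prime p" "e > v" "p ^ v dvd n" "\<not> p ^ Suc v dvd n"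
  shows "quad_count (p ^ e) (\<lambda>a b c d. p ^ e dvd a * d - b * c - n) =
    (of_int p ^ e) ^ 3 * (1 + 1 / of_int p) * (1 - 1 / of_int p ^ Suc v)"
  using assms(2-)
proof (induction v arbitrary: e n)
  case 0
  then obtain f where e: "e = Suc f" by (cases e) auto
  have p: "p > 0" using assms(1) by (rule prime_gt_0_int)
  then have "p ^ f > 0" by simp
  from quad_count_det_rec[OF assms(1) this coprime_prime_power_iff[OF assms(1)], of n] 0 show ?case
    by (simp only: e power_Suc) (use p in \<open>simp add: field_simps power2_eq_square power3_eq_cube\<close>)
next
  case (Suc v)
  then obtain f where e: "e = Suc f" by (cases e) auto
  have p: "p > 0" using assms(1) by (rule prime_gt_0_int)
  from Suc.prems(2) have "p dvd n" by (simp add: dvd_mult_left)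
  then obtain n' where n: "n = p * n'" ..
  have IH: "quad_count (p ^ f) (\<lambda>a b c d. p ^ f dvd a * d - b * c - n') =
      (of_int p ^ f) ^ 3 * (1 + 1 / of_int p) * (1 - 1 / of_int p ^ Suc v)"
    using Suc.prems p by (intro Suc.IH) (auto simp: n e)
  have "n div p = n'" "p dvd n" using p by (simp_all add: n)
  moreover have "p ^ f > 0" using p by simp
  note quad_count_det_rec[OF assms(1) this coprime_prime_power_iff[OF assms(1)], of n]
  ultimately show ?case
    by (simp only: e power_Suc if_True IH) (use p in \<open>simp add: field_simps power2_eq_square power3_eq_cube\<close>)
qed

section \<open>Matrices with prescribed determinant and trace\<close>

lemma sum_mult_const:
  "(\<Sum>x\<in>A. f x * r) = (\<Sum>x\<in>A. f x) * (r :: 'a :: semiring_0)"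
  by (rule sum_distrib_right [symmetric])

text \<open>
  With the trace prescribed modulo \<open>p\<close>, the characteristic polynomial reduces to
  \<open>(x + 1) (x + n)\<close>; when \<open>p\<close> divides \<open>b\<close>, one of the diagonal entries is therefore \<open>-1\<close>,
  and the other one is determined by the determinant.
\<close>

lemma quad_count_det_trace:
  fixes p k n :: int
  assumes "prime p" "k > 0" and k: "\<And>u. coprime u (p * k) \<longleftrightarrow> \<not> p dvd u"
  shows "quad_count (p * k) (\<lambda>a b c d. p * k dvd a * d - b * c - n \<and> p dvd a + d + 1 + n) =
    of_int k ^ 3 * ((of_int p)\<^sup>2 + (if p dvd n - 1 then 0 else of_int p))"
proof -
  let ?I = "{0..<p * k}" and ?m = "of_int p * of_int k :: real"
  let ?D = "\<lambda>a b c d. p * k dvd a * d - b * c - n"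
  have p: "p > 0" using assms(1) by (rule prime_gt_0_int)
  then have m: "p * k > 0" using assms(2) by simp
  have card_I: "(\<Sum>x\<in>?I. r) = ?m * r" for r :: real using m by simp
  have unit: "(\<Sum>x\<in>?I. of_bool (\<not> p dvd x)) = ?m - of_int k"
    by (rule sum_residues_coprime[OF p assms(2)])
  have divs: "(\<Sum>x\<in>?I. of_bool (p dvd x + r)) = real_of_int k" for r
    using sum_residues_unique_divisor[OF p assms(2), of 1 r] by simp
  \<comment> \<open>An entry whose cofactor is a unit is determined by the determinant and the other
    three entries.\<close>
  have a_unique: "(\<Sum>a\<in>?I. of_bool (?D a b c d)) = (1 :: real)" if "\<not> p dvd d" for b c d
  proof -
    have "a * d - b * c - n = d * a + (- b * c - n)" for a by simp
    with sum_residues_unique[OF m, of d "- b * c - n"] k that show ?thesis by (simp only: simp_thms)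
  qed
  have c_unique: "(\<Sum>c\<in>?I. of_bool (?D a b c d)) = (1 :: real)" if "\<not> p dvd b" for a b d
  proof -
    have "a * d - b * c - n = - b * c + (a * d - n)" for c by simp
    with sum_residues_unique[OF m, of "- b" "a * d - n"] k that show ?thesis
      by (simp only: simp_thms dvd_minus_iff)
  qed
  have d_unique: "(\<Sum>d\<in>?I. of_bool (?D a b c d)) = (1 :: real)" if "\<not> p dvd a" for a b c
  proof -
    have "a * d - b * c - n = a * d + (- b * c - n)" for d by simp
    with sum_residues_unique[OF m, of a "- b * c - n"] k that show ?thesis by (simp only: simp_thms)
  qed
  \<comment> \<open>A diagonal entry congruent to -1 is a unit, as \<open>a_unique\<close> and
    \<open>d_unique\<close> require.\<close>
  have not_dvd: "\<not> p dvd x" if "p dvd x + 1" for x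
    using that assms(1) by (metis dvd_add_right_iff not_prime_unit)
  \<comment> \<open>Here \<open>a\<close> is free, \<open>b\<close> has \<open>?m - k\<close>
    values, the trace leaves \<open>k\<close> values for \<open>d\<close>, and \<open>c\<close> is
    then determined.\<close>
  have b_unit: "quad_count (p * k) (\<lambda>a b c d. (?D a b c d \<and> p dvd a + d + 1 + n) \<and> \<not> p dvd b) =
      ?m * (?m - of_int k) * of_int k"
  proof -
    have "(\<Sum>c\<in>?I. \<Sum>d\<in>?I. of_bool ((?D a b c d \<and> p dvd a + d + 1 + n) \<and> \<not> p dvd b)) =
        of_bool (\<not> p dvd b) * real_of_int k" for a b
    proof (cases "p dvd b")
      case False
      have "(\<Sum>c\<in>?I. \<Sum>d\<in>?I. of_bool ((?D a b c d \<and> p dvd a + d + 1 + n) \<and> \<not> p dvd b)) =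
          (\<Sum>d\<in>?I. of_bool (p dvd d + (a + 1 + n)) * (\<Sum>c\<in>?I. of_bool (?D a b c d) :: real))"
        unfolding sum_distrib_left
        by (subst sum.swap, intro sum.cong refl) (use False in \<open>auto simp: algebra_simps\<close>)
      then show ?thesis using False by (simp only: c_unique[OF False] divs mult_1_right) simp
    qed simp
    then show ?thesis
      unfolding quad_count_def by (simp only: sum_mult_const unit card_I mult.assoc)
  qed
  \<comment> \<open>\<open>A\<close> and \<open>B\<close> treat \<open>p dvd b\<close>: there are
    \<open>k\<close> choices for \<open>b\<close> and \<open>k\<close> for the diagonal entry
    congruent to -1, \<open>c\<close> is free, and the other diagonal entry is determined.\<close>
  have A: "quad_count (p * k) (\<lambda>a b c d. ?D a b c d \<and> p dvd b \<and> p dvd a + 1) = of_int k * of_int k * ?m"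
  proof -
    \<comment> \<open>Writing \<open>b + 0\<close> makes the condition an instance of
      \<open>divs\<close>.\<close>
    have "(\<Sum>c\<in>?I. \<Sum>d\<in>?I. of_bool (?D a b c d \<and> p dvd b \<and> p dvd a + 1)) =
        of_bool (p dvd a + 1) * (of_bool (p dvd b + 0) * ?m)" for a b
    proof (cases "p dvd b \<and> p dvd a + 1")
      case True
      then have "(\<Sum>c\<in>?I. \<Sum>d\<in>?I. of_bool (?D a b c d \<and> p dvd b \<and> p dvd a + 1)) =
          (\<Sum>c\<in>?I. \<Sum>d\<in>?I. of_bool (?D a b c d) :: real)" by (simp only: simp_thms)
      also have "\<dots> = ?m" using True by (simp only: d_unique[OF not_dvd] card_I)
      finally show ?thesis using True by simp
    qed auto
    then show ?thesis
      unfolding quad_count_def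
      by (simp only: sum_mult_const divs mult.assoc flip: sum_distrib_left)
  qed
  have B: "quad_count (p * k) (\<lambda>a b c d. ?D a b c d \<and> p dvd b \<and> p dvd d + 1) = of_int k * of_int k * ?m"
  proof -
    have "(\<Sum>a\<in>?I. \<Sum>c\<in>?I. \<Sum>d\<in>?I. of_bool (?D a b c d \<and> p dvd b \<and> p dvd d + 1)) =
        of_bool (p dvd b + 0) * (?m * real_of_int k)" for b
    proof -
      have inner: "(\<Sum>a\<in>?I. of_bool (?D a b c d \<and> p dvd b \<and> p dvd d + 1)) =
          of_bool (p dvd d + 1) * (of_bool (p dvd b + 0) :: real)" for c d
      proof (cases "p dvd b \<and> p dvd d + 1")
        case True
        then have "(\<Sum>a\<in>?I. of_bool (?D a b c d \<and> p dvd b \<and> p dvd d + 1)) =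
            (\<Sum>a\<in>?I. of_bool (?D a b c d) :: real)" by (simp only: simp_thms)
        then show ?thesis using True by (simp add: a_unique[OF not_dvd])
      qed auto
      \<comment> \<open>The determined entry is now \<open>a\<close>, so its sum has to become the
        innermost one.\<close>
      have "(\<Sum>a\<in>?I. \<Sum>c\<in>?I. \<Sum>d\<in>?I. of_bool (?D a b c d \<and> p dvd b \<and> p dvd d + 1)) =
          (\<Sum>c\<in>?I. \<Sum>d\<in>?I. \<Sum>a\<in>?I. of_bool (?D a b c d \<and> p dvd b \<and> p dvd d + 1) :: real)"
        by (rule trans[OF sum.swap]) (intro sum.cong refl sum.swap)
      also have "\<dots> = of_bool (p dvd b + 0) * (?m * real_of_int k)"
        unfolding inner sum_mult_const divs card_I by simp
      finally show ?thesis .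
    qed
    note row = this
    show ?thesis
      unfolding quad_count_def by (rule trans[OF sum.swap]) (unfold row sum_mult_const divs, simp)
  qed
  \<comment> \<open>Modulo \<open>p\<close>, b = 0 gives a d = n, hence (a + 1) (d + 1) = a + d + 1
    + n.\<close>
  have split: "?D a b c d \<and> p dvd a + d + 1 + n \<longleftrightarrow> ?D a b c d \<and> (p dvd a + 1 \<or> p dvd d + 1)"
    if b: "p dvd b" for a b c d
  proof -
    have "p dvd a + d + 1 + n \<longleftrightarrow> p dvd (a + 1) * (d + 1)" if "?D a b c d"
    proof -
      have "p dvd a * d - b * c - n" using that by (rule dvd_mult_left)
      moreover have "a * d - n = (a * d - b * c - n) + b * c" by simp
      ultimately have "p dvd a * d - n"
        using b by (metis dvd_add dvd_mult2)
      moreover have "(a + 1) * (d + 1) = (a + d + 1 + n) + (a * d - n)" by (simp add: algebra_simps)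
      ultimately show ?thesis by (metis dvd_add_left_iff)
    qed
    then show ?thesis using assms(1) by (auto simp: prime_dvd_mult_iff)
  qed
  \<comment> \<open>With b = 0 and a = -1 modulo \<open>p\<close>, the determinant condition reads d
    = -n.\<close>
  have both: "p dvd n - 1 \<longleftrightarrow> p dvd d + 1" if "p * k dvd a * d - b * c - n" "p dvd b" "p dvd a + 1" for a b c d
  proof -
    have "p dvd a * d - b * c - n" using that(1) by (rule dvd_mult_left)
    moreover have "(a + 1) * d - b * c - (d + 1) - (a * d - b * c - n) = n - 1"
      by (simp add: algebra_simps)
    moreover have "p dvd (a + 1) * d - b * c" using that by simp
    ultimately show ?thesis by (metis dvd_diff_left_iff dvd_diff_right_iff)
  qed
  \<comment> \<open>If n = 1 modulo \<open>p\<close>, the cases a = -1 and d = -1 coincide and are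
    counted once; otherwise they exclude each other.\<close>
  have "quad_count (p * k) (\<lambda>a b c d. (?D a b c d \<and> p dvd a + d + 1 + n) \<and> p dvd b) =
     quad_count (p * k) (\<lambda>a b c d. ?D a b c d \<and> p dvd b \<and> p dvd a + 1) +
     (if p dvd n - 1 then 0 else quad_count (p * k) (\<lambda>a b c d. ?D a b c d \<and> p dvd b \<and> p dvd d + 1))"
  proof (cases "p dvd n - 1")
    case True
    have "(?D a b c d \<and> p dvd a + d + 1 + n) \<and> p dvd b \<longleftrightarrow> ?D a b c d \<and> p dvd b \<and> p dvd a + 1" for a b c d
      using split[of b a d c] both[of a d b c] both[of d a b c] True by (auto simp: mult.commute[of d a])
    then show ?thesis using True by (simp cong: quad_count_cong)
  next
    case False
    have "((?D a b c d \<and> p dvd a + d + 1 + n) \<and> p dvd b) \<and> p dvd a + 1 \<longleftrightarrow> ?D a b c d \<and> p dvd b \<and> p dvd a + 1"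
         "((?D a b c d \<and> p dvd a + d + 1 + n) \<and> p dvd b) \<and> \<not> p dvd a + 1 \<longleftrightarrow> ?D a b c d \<and> p dvd b \<and> p dvd d + 1"
      for a b c d
      using split[of b a d c] both[of a d b c] False by auto
    then show ?thesis
      using False by (subst quad_count_split[where Q = "\<lambda>a b c d. p dvd a + 1"]) (simp cong: quad_count_cong)
  qed
  then show ?thesis
    using quad_count_split[of "p * k" "\<lambda>a b c d. ?D a b c d \<and> p dvd a + d + 1 + n" "\<lambda>a b c d. p dvd b"]
    unfolding A B b_unit
    by (simp add: power2_eq_square power3_eq_cube algebra_simps split: if_splits)
qed

section \<open>Matrices over Z/m as quadruples of residues\<close>

text \<open>Translation by the identity matrix permutes the matrices modulo \<open>m\<close>; it
  moves only the diagonal entries, so periodicity is asked of these.\<close>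

lemma quad_count_shift_diagonal:
  assumes "m > 0"
    and "\<And>a b c d. P (a mod m) b c d \<longleftrightarrow> P a b c d" "\<And>a b c d. P a b c (d mod m) \<longleftrightarrow> P a b c d"
  shows "quad_count m (\<lambda>a b c d. P (a + 1) b c (d + 1)) = quad_count m P"
proof -
  have shift: "(\<Sum>x\<in>{0..<m}. f (x + 1)) = (\<Sum>x\<in>{0..<m}. f x)" if "\<And>x. f (x mod m) = f x" for f :: "int \<Rightarrow> real"
    using sum_residues_affine[of m 1 f 1] assms(1) that by simp
  have "(\<Sum>d\<in>{0..<m}. of_bool (P a b c (d + 1))) = (\<Sum>d\<in>{0..<m}. of_bool (P a b c d) :: real)" for a b c
    by (rule shift) (simp add: assms)
  then show ?thesis
    unfolding quad_count_def
    by (simp only:) (rule shift, simp add: assms)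
qed

lemma card_Mat2_mod:
  "real (card {A \<in> Mat2_mod m. P (A$1$1) (A$1$2) (A$2$1) (A$2$2)}) = quad_count (int m) P"
proof -
  let ?I = "{0..<int m}"
  let ?T = "{t \<in> ?I \<times> ?I \<times> ?I \<times> ?I. case t of (a, b, c, d) \<Rightarrow> P a b c d}"
  have "bij_betw (\<lambda>A. (A$1$1, A$1$2, A$2$1, A$2$2)) {A \<in> Mat2_mod m. P (A$1$1) (A$1$2) (A$2$1) (A$2$2)} ?T"
    by (rule bij_betwI[where g = "\<lambda>(a, b, c, d). vector [vector [a, b], vector [c, d]]"])
       (auto simp: Mat2_mod_def forall_2 vec_eq_iff)
  then have "card {A \<in> Mat2_mod m. P (A$1$1) (A$1$2) (A$2$1) (A$2$2)} = card ?T"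
    by (rule bij_betw_same_card)
  moreover have "real (card ?T) = (\<Sum>t\<in>?I \<times> ?I \<times> ?I \<times> ?I. of_bool (case t of (a, b, c, d) \<Rightarrow> P a b c d))"
    by (simp add: sum_of_bool_eq Collect_conj_eq)
  moreover have "\<dots> = quad_count (int m) P"
    unfolding quad_count_def sum.cartesian_product by (intro sum.cong) auto
  ultimately show ?thesis by simp
qed

text \<open>One direction is multiplicativity of the determinant; in the other, the adjugate divided
  by the determinant is an inverse.\<close>

lemma GL2_mod_iff_coprime_det:
  assumes "m > 0"
  shows "A \<in> GL2_mod m \<longleftrightarrow> A \<in> Mat2_mod m \<and> coprime (det A) (int m)"
proof safe
  assume "A \<in> GL2_mod m"
  then show "A \<in> Mat2_mod m" by (simp add: GL2_mod_def)
  from \<open>A \<in> GL2_mod m\<close> obtain B where "mat_cong (A ** B) (mat 1) m" by (auto simp: GL2_mod_def)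
  then have AB: "[(A ** B) $ i $ j = mat 1 $ i $ j] (mod int m)" for i j by (simp add: mat_cong_def)
  have "[det (A ** B) = det (mat 1 :: int^2^2)] (mod int m)"
    unfolding det_2 by (intro cong_diff cong_mult AB)
  then have "[det A * det B = 1] (mod int m)" by (simp add: det_mul)
  then show "coprime (det A) (int m)"
    by (auto simp: coprime_iff_invertible_int)
next
  assume A: "A \<in> Mat2_mod m" and "coprime (det A) (int m)"
  then obtain r where r: "[det A * r = 1] (mod int m)" by (auto simp: coprime_iff_invertible_int)
  \<comment> \<open>\<open>B0\<close> is \<open>r\<close> times the adjugate of \<open>A\<close>;
    \<open>B\<close> reduces it to the canonical representatives demanded by
    \<open>Mat2_mod\<close>.\<close>
  define B0 :: "int^2^2" where "B0 = vector [vector [r * A$2$2, - r * A$1$2], vector [- r * A$2$1, r * A$1$1]]"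
  define B :: "int^2^2" where "B = (\<chi> i j. B0$i$j mod int m)"
  have B: "[B$i$j = B0$i$j] (mod int m)" for i j by (simp add: B_def)
  have scalar: "[mat (det A * r) $ i $ j = mat 1 $ i $ (j::2)] (mod int m)" for i j
    using r by (simp add: mat_def)
  have "B \<in> Mat2_mod m" using assms by (simp add: B_def Mat2_mod_def)
  moreover have "mat_cong (A ** B) (mat 1) m"
  proof -
    have "[(A ** B) $ i $ j = (A ** B0) $ i $ j] (mod int m)" for i j
      by (auto simp: matrix_matrix_mult_def intro!: cong_sum cong_mult B)
    moreover have "A ** B0 = mat (det A * r)"
      by (simp add: vec_eq_iff forall_2 matrix_matrix_mult_def sum_2 mat_def B0_def det_2 algebra_simps)
    ultimately show ?thesis unfolding mat_cong_def by (auto intro: cong_trans[OF _ scalar] simp only:)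
  qed
  moreover have "mat_cong (B ** A) (mat 1) m"
  proof -
    have "[(B ** A) $ i $ j = (B0 ** A) $ i $ j] (mod int m)" for i j
      by (auto simp: matrix_matrix_mult_def intro!: cong_sum cong_mult B)
    moreover have "B0 ** A = mat (det A * r)"
      by (simp add: vec_eq_iff forall_2 matrix_matrix_mult_def sum_2 mat_def B0_def det_2 algebra_simps)
    ultimately show ?thesis unfolding mat_cong_def by (auto intro: cong_trans[OF _ scalar] simp only:)
  qed
  ultimately show "A \<in> GL2_mod m"
    using A unfolding GL2_mod_def by blast
qed

section \<open>The local factors\<close>

text \<open>Numerator and denominator are both (l^e)^4 times an expression free of \<open>e\<close>,
  so the ratio is constant in the range of \<open>e\<close> where \<open>quad_count_det\<close>
  applies.\<close>

lemma local_ratio_formula: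
  assumes "prime l" "N > 0" "e > multiplicity l N"
  shows "local_ratio N l e =
    ((1 + 1 / real l) * (1 - 1 / real l ^ Suc (multiplicity l N))
      - (1 / real l + (if int l dvd int N - 1 then 0 else 1 / (real l)\<^sup>2)))
    / ((1 - 1 / (real l)\<^sup>2) * (1 - 1 / real l))"
proof -
  define p where "p = int l"
  have p: "prime p" and p0: "p > 0" using assms(1) by (simp_all add: p_def prime_gt_0_nat)
  obtain f where e: "e = Suc f" using assms(3) by (cases e) auto
  define k where "k = p ^ f"
  define n where "n = int N"
  have k0: "k > 0" using p0 by (simp add: k_def)
  have m: "int (l ^ e) = p * k" by (simp add: e p_def k_def)
  have m': "p * k = p ^ e" by (simp add: e k_def)
  have m0: "p * k > 0" using p0 k0 by simp
  have cop: "coprime u (p * k) \<longleftrightarrow> \<not> p dvd u" for u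
    unfolding k_def by (rule coprime_prime_power_iff[OF p])
  have GL2: "A \<in> GL2_mod (l ^ e) \<longleftrightarrow> A \<in> Mat2_mod (l ^ e) \<and> \<not> p dvd A$1$1 * A$2$2 - A$1$2 * A$2$1" for A
    using GL2_mod_iff_coprime_det[of "l ^ e" A] prime_gt_0_nat[OF assms(1)] unfolding m cop det_2 by simp
  let ?D = "\<lambda>a b c d. p * k dvd a * d - b * c - n"
  let ?P = "\<lambda>a b c d. \<not> p dvd a * d - b * c \<and> p * k dvd a * d - b * c + 1 - (a + d) - n"
  have "real (card {A \<in> GL2_mod (l ^ e). [det A + 1 - trace A = int N] (mod int (l ^ e))}) =
      real (card {A \<in> Mat2_mod (l ^ e). ?P (A$1$1) (A$1$2) (A$2$1) (A$2$2)})"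
    unfolding GL2 m cong_iff_dvd_diff det_2 trace_def sum_2 n_def
    by (intro arg_cong[where f = "\<lambda>S. real (card S)"] Collect_cong) simp
  also have "\<dots> = quad_count (p * k) ?P"
    by (subst card_Mat2_mod) (simp only: m)
  \<comment> \<open>This is the substitution of M + 1 for the matrix being counted.\<close>
  also have "\<dots> = quad_count (p * k) (\<lambda>a b c d. ?P (a + 1) b c (d + 1))"
  proof (rule quad_count_shift_diagonal[OF m0, symmetric])
    have *: "[x mod (p * k) = x] (mod p)" for x by (rule cong_dvd_modulus[of _ _ "p * k"]) simp_all
    show "?P (a mod (p * k)) b c d \<longleftrightarrow> ?P a b c d" for a b c d
      by (intro arg_cong2[where f = "(\<and>)"] arg_cong[where f = Not] cong_dvd_iff cong_diff cong_add cong_mult cong_refl *) simp_all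
    show "?P a b c (d mod (p * k)) \<longleftrightarrow> ?P a b c d" for a b c d
      by (intro arg_cong2[where f = "(\<and>)"] arg_cong[where f = Not] cong_dvd_iff cong_diff cong_add cong_mult cong_refl *) simp_all
  qed
  also have "\<dots> = quad_count (p * k) (\<lambda>a b c d. ?D a b c d \<and> \<not> p dvd a + d + 1 + n)"
  proof (rule quad_count_cong)
    fix a b c d
    \<comment> \<open>The first identity turns the congruence into det M = n; the second then gives
      det (M + 1) = tr M + 1 + n modulo \<open>p\<close>.\<close>
    have eq: "(a + 1) * (d + 1) - b * c + 1 - (a + 1 + (d + 1)) - n = a * d - b * c - n"
      "(a + 1) * (d + 1) - b * c = (a * d - b * c - n) + (a + d + 1 + n)" by (simp_all add: algebra_simps)
    have "p dvd (a + 1) * (d + 1) - b * c \<longleftrightarrow> p dvd a + d + 1 + n" if "?D a b c d"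
      unfolding eq(2) using dvd_mult_left[OF that] by (rule dvd_add_right_iff)
    then show "?P (a + 1) b c (d + 1) \<longleftrightarrow> ?D a b c d \<and> \<not> p dvd a + d + 1 + n" unfolding eq(1) by blast
  qed
  also have "\<dots> = quad_count (p * k) ?D - quad_count (p * k) (\<lambda>a b c d. ?D a b c d \<and> p dvd a + d + 1 + n)"
    using quad_count_split[of "p * k" ?D "\<lambda>a b c d. p dvd a + d + 1 + n"] by simp
  also have "quad_count (p * k) ?D = (of_int (p * k)) ^ 3 * (1 + 1 / of_int p) * (1 - 1 / of_int p ^ Suc (multiplicity l N))"
  proof -
    have "p ^ multiplicity l N dvd n"
      by (simp add: p_def n_def multiplicity_dvd flip: of_nat_power)
    moreover have "\<not> p ^ Suc (multiplicity l N) dvd n"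
    proof -
      have "\<not> l ^ Suc (multiplicity l N) dvd N"
        using assms(1,2) by (subst power_dvd_iff_le_multiplicity) (auto simp: not_prime_unit)
      then show ?thesis by (simp add: p_def n_def flip: of_nat_power of_nat_mult)
    qed
    ultimately show ?thesis
      unfolding m' using quad_count_det[OF p assms(3)] by simp
  qed
  also note quad_count_det_trace[OF p k0 cop]
  finally have num: "real (card {A \<in> GL2_mod (l ^ e). [det A + 1 - trace A = int N] (mod int (l ^ e))}) =
     of_int (p * k) ^ 3 * (1 + 1 / of_int p) * (1 - 1 / of_int p ^ Suc (multiplicity l N)) -
     of_int k ^ 3 * ((of_int p)\<^sup>2 + (if p dvd n - 1 then 0 else of_int p))" .
  have "real (card (GL2_mod (l ^ e))) = real (card {A \<in> Mat2_mod (l ^ e). \<not> p dvd A$1$1 * A$2$2 - A$1$2 * A$2$1})"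
    by (simp flip: GL2)
  also have "\<dots> = quad_count (p * k) (\<lambda>a b c d. \<not> p dvd a * d - b * c)"
    by (subst card_Mat2_mod) (simp only: m)
  also note quad_count_unit_det[OF p k0]
  finally have den: "real (card (GL2_mod (l ^ e))) =
    ((of_int p * of_int k)\<^sup>2 - (of_int k)\<^sup>2) * (of_int p * of_int k * (of_int p * of_int k - of_int k))" .
  define L where "L = real l"
  define K where "K = real_of_int k"
  \<comment> \<open>\<open>W\<close> hides the symbolic exponent and \<open>t\<close> the case
    distinction; what remains is rational arithmetic, with \<open>L * K\<close> equal to
    l^e.\<close>
  define W where "W = 1 / L ^ Suc (multiplicity l N)"
  define t :: real where "t = (if p dvd n - 1 then 0 else 1)"
  have L: "L > 1" using prime_gt_1_nat[OF assms(1)] by (simp add: L_def)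
  have K: "K > 0" using k0 by (simp add: K_def)
  have "local_ratio N l e = (L * K) * ((L * K) ^ 3 * (1 + 1 / L) * (1 - W) - K ^ 3 * (L\<^sup>2 + L * t))
     / (((L * K)\<^sup>2 - K\<^sup>2) * (L * K * (L * K - K)))"
    unfolding local_ratio_def num den
    by (simp add: L_def K_def W_def t_def p_def e k_def)
  also have "\<dots> = ((L * K) ^ 4 * ((1 + 1 / L) * (1 - W) - (1 / L + t / L\<^sup>2)))
     / ((L * K) ^ 4 * ((1 - 1 / L\<^sup>2) * (1 - 1 / L)))"
    by (rule arg_cong2[where f = "(/)"]) (use L in \<open>simp_all add: field_simps power2_eq_square power3_eq_cube power4_eq_xxxx\<close>)
  also have "\<dots> = ((1 + 1 / L) * (1 - W) - (1 / L + t / L\<^sup>2)) / ((1 - 1 / L\<^sup>2) * (1 - 1 / L))"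
    using L K by simp
  finally show ?thesis
    by (simp add: L_def W_def t_def p_def n_def)
qed

text \<open>Squaring discards the sign, so at 2 as at odd primes only divisibility is seen. This
  matches the Kronecker symbol with the case distinction in the trace count.\<close>

lemma kronecker_prime_square:
  assumes "prime l"
  shows "(kronecker_prime a l)\<^sup>2 = (if int l dvd a then 0 else 1)"
  using assms by (auto simp: kronecker_prime_def Legendre_def cong_0_iff)

text \<open>If \<open>l\<close> divides \<open>N\<close>, it cannot divide N - 1, and the additional
  factor 1 / (1 - 1/l) is the contribution of \<open>l\<close> to N / phi(N). Otherwise the
  valuation is 0 and the Kronecker symbol carries the case distinction.\<close>

lemma local_ratio_eq:
  assumes "prime l" "N > 0" "e > multiplicity l N"
  shows "local_ratio N l e =
    (if l dvd N then (1 - 1 / (real l ^ multiplicity l N * (real l - 1))) * (1 / (1 - 1 / real l))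
     else K_coprime_factor N l)"
proof -
  define L where "L = real l"
  have L: "L > 1" using prime_gt_1_nat[OF assms(1)] by (simp add: L_def)
  then have nz: "L - 1 \<noteq> 0" "L + 1 \<noteq> 0" "L \<noteq> 0" by auto
  have den: "(1 - 1 / L\<^sup>2) * (1 - 1 / L) = (L - 1)\<^sup>2 * (L + 1) / L ^ 3"
    using nz by (simp add: field_simps power2_eq_square power3_eq_cube)
  show ?thesis
  proof (cases "l dvd N")
    case True
    then have "\<not> int l dvd int N - 1"
      using assms(1) by (metis dvd_diff_right_iff int_dvd_int_iff int_ops(2) not_prime_unit)
    moreover define W where "W = L ^ multiplicity l N"
    moreover have "W > 0" using L by (simp add: W_def)
    ultimately show ?thesis
      unfolding local_ratio_formula[OF assms] L_def[symmetric] power_Suc den using nz True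
      by (simp add: divide_simps) (simp add: algebra_simps power2_eq_square power3_eq_cube)
  next
    case False
    then have "multiplicity l N = 0" by (rule not_dvd_imp_multiplicity_0)
    then show ?thesis
      unfolding local_ratio_formula[OF assms] K_coprime_factor_def kronecker_prime_square[OF assms(1)]
        L_def[symmetric] den using nz False
      by (simp add: divide_simps) (simp add: algebra_simps power2_eq_square power3_eq_cube)
  qed
qed

section \<open>The limit and the Euler product\<close>

lemma lim_local_ratio:
  assumes "prime l" "N > 0"
  shows "lim (local_ratio N l) = local_ratio N l (Suc (multiplicity l N))"
proof (rule limI, rule tendsto_eventually)
  show "\<forall>\<^sub>F e in sequentially. local_ratio N l e = local_ratio N l (Suc (multiplicity l N))"
    using eventually_gt_at_top[of "multiplicity l N"]
    by eventually_elim (simp add: local_ratio_eq[OF assms])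
qed

theorem theoremA1:
  fixes N :: nat
  assumes "N > 0"
  shows "(\<lambda>l. if prime l then lim (local_ratio N l) else 1)
           has_prod (K_const N * real N / real (totient N)) \<and>
         (\<forall>l. prime l \<longrightarrow>
           (\<forall>e e'. e > multiplicity l N \<and> e' > multiplicity l N \<longrightarrow>
              local_ratio N l e = local_ratio N l e'))"
proof
  \<comment> \<open>\<open>?g\<close> carries the infinite product in K(N); \<open>?h\<close>
    carries the finite one, with the factors of N / phi(N) merged in.\<close>
  let ?g = "\<lambda>l. if prime l \<and> \<not> l dvd N then K_coprime_factor N l else 1"
  let ?F = "\<lambda>l. 1 - 1 / (real l ^ multiplicity l N * (real l - 1))"
  let ?h = "\<lambda>l. if l \<in> prime_factors N then ?F l * (1 / (1 - 1 / real l)) else 1"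
  have "?g has_prod prodinf ?g"
    by (intro convergent_prod_has_prod abs_convergent_prod_imp_convergent_prod abs_convergent_K)
  moreover have "?h has_prod (\<Prod>l\<in>prime_factors N. ?F l * (1 / (1 - 1 / real l)))"
    by (rule has_prod_If_finite_set) simp
  ultimately have "(\<lambda>l. ?g l * ?h l) has_prod
      (prodinf ?g * (\<Prod>l\<in>prime_factors N. ?F l * (1 / (1 - 1 / real l))))"
    by (rule has_prod_mult)
  moreover have "(\<lambda>l. if prime l then lim (local_ratio N l) else 1) = (\<lambda>l. ?g l * ?h l)"
    using assms by (auto simp: fun_eq_iff lim_local_ratio local_ratio_eq in_prime_factors_iff)
  \<comment> \<open>\<open>totient_formula2\<close> writes phi(N) as N times the product of 1 - 1/l
    over the prime factors of \<open>N\<close>.\<close>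
  moreover have "prodinf ?g * (\<Prod>l\<in>prime_factors N. ?F l * (1 / (1 - 1 / real l))) = K_const N * real N / real (totient N)"
    using assms unfolding K_const_def totient_formula2 prod.distrib prod_dividef by simp
  ultimately show "(\<lambda>l. if prime l then lim (local_ratio N l) else 1)
           has_prod (K_const N * real N / real (totient N))"
    by simp
next
  show "\<forall>l. prime l \<longrightarrow>
           (\<forall>e e'. e > multiplicity l N \<and> e' > multiplicity l N \<longrightarrow>
              local_ratio N l e = local_ratio N l e')"
    using assms by (simp add: local_ratio_eq)
qed

end
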